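(* Let $S$ be a finite set and let $f$ be a permutation of $S$. Let $\mathbf{Z}_i=\{Z_{i,1},\dots,Z_{i,n_i}\}$ be the set of $f$-cycles of length $i$ and let $\mathbf{Z}=\bigsqcup_i\mathbf{Z}_i$. For every $f$-cycle $Z_{i,j}$ choose an element $x_{i,j}\in\mathcal{V}(Z_{i,j})$, and let $X$ be the set of all the chosen elements. Then every function $g:S\to S$ with $fg=gf$ is bijectively determined by the pair $[\widetilde g,g|_X]$, where $\widetilde g$ is the map induced by $g$ on $f$-cycles. That is, $g\mapsto[\widetilde g,g|_X]$ is a bijection from the set $\{g:S\to S\mid fg=gf\}$ onto the set of pairs $[\pi,h]$ such that: (1) $\pi:\mathbf{Z}\to\mathbf{Z}$ is a function such that $|\mathcal{V}(\pi(Z_{i,j}))|$ divides $i$ for all $i,j$; (2) $h:X\to S$ is a function with $h(x_{i,j})\in\mathcal{V}(\pi(Z_{i,j}))$ for all $i,j$.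
   Context: For a permutation $f$ of a finite set $S$, the $f$-cycles are the directed cycles of the functional graph with vertex set $S$ and edges $[s,f(s)]$, $s\in S$ (fixed points are cycles of length $1$); $\mathcal{V}(Z)$ is the vertex set of $Z$. A function $g$ commuting with $f$ maps the vertex set of each $f$-cycle onto the vertex set of an $f$-cycle, and $\widetilde g(Z)$ denotes the $f$-cycle with vertex set $g(\mathcal{V}(Z))$. *)

theory Defs
  imports "Graph_Theory.Pair_Digraph" "HOL-Combinatorics.Orbits"
begin

definition functional_graph :: "'a set \<Rightarrow> ('a \<Rightarrow> 'a) \<Rightarrow> 'a pair_pre_digraph" where
  "functional_graph S f = \<lparr> pverts = S, parcs = {(s, f s) |s. s \<in> S} \<rparr>"

(* A directed cycle is a subgraph, so it does not remember at which vertex a closed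
   walk running around it starts. The library's cycles are closed arc walks without
   repeated vertices; loops, hence fixed points of f, are included. *)
definition f_cycles :: "'a set \<Rightarrow> ('a \<Rightarrow> 'a) \<Rightarrow> 'a pair_pre_digraph set" where
  "f_cycles S f =
     {\<lparr> pverts = fst ` set p, parcs = set p \<rparr> |p.
        pre_digraph.cycle (with_proj (functional_graph S f)) p}"

definition cycle_length :: "'a pair_pre_digraph \<Rightarrow> nat" where
  "cycle_length Z = card (parcs Z)"

definition commuting_maps :: "'a set \<Rightarrow> ('a \<Rightarrow> 'a) \<Rightarrow> ('a \<Rightarrow> 'a) set" where
  "commuting_maps S f = {g \<in> S \<rightarrow>\<^sub>E S. \<forall>s\<in>S. f (g s) = g (f s)}"

(* The description is proper when f permutes the finite set S and g commutes with f:
   see induced_map_well_defined below. *)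
definition induced_map ::
  "'a set \<Rightarrow> ('a \<Rightarrow> 'a) \<Rightarrow> ('a \<Rightarrow> 'a) \<Rightarrow> 'a pair_pre_digraph \<Rightarrow> 'a pair_pre_digraph" where
  "induced_map S f g =
     (\<lambda>Z \<in> f_cycles S f. THE W. W \<in> f_cycles S f \<and> pverts W = g ` pverts Z)"

lemma functional_graph_walk:
  assumes "pcas u p v" "set p \<subseteq> parcs (functional_graph S f)"
  shows "p = map (\<lambda>k. ((f ^^ k) u, (f ^^ Suc k) u)) [0..<length p] \<and> v = (f ^^ length p) u"
  using assms
proof (induction p arbitrary: u)
  case Nil
  then show ?case by simp
next
  case (Cons e p)
  then have e: "e = (u, f u)" by (auto simp: functional_graph_def)
  have IH: "p = map (\<lambda>k. ((f ^^ k) (f u), (f ^^ Suc k) (f u))) [0..<length p]"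
    and v: "v = (f ^^ length p) (f u)"
    using Cons.IH[of "snd e"] Cons.prems e by auto
  have "map (\<lambda>k. ((f ^^ k) u, (f ^^ Suc k) u)) [0..<Suc (length p)]
      = e # map (\<lambda>k. ((f ^^ k) (f u), (f ^^ Suc k) (f u))) [0..<length p]"
    unfolding upt_conv_Cons[OF zero_less_Suc] map_Suc_upt[symmetric]
    by (simp add: e funpow_swap1)
  then show ?case using IH v by (simp add: funpow_swap1)
qed

lemma funpow_walk:
  assumes "s \<in> S" "\<And>t. t \<in> S \<Longrightarrow> f t \<in> S"
  shows "pcas s (map (\<lambda>k. ((f ^^ k) s, (f ^^ Suc k) s)) [0..<n]) ((f ^^ n) s)
       \<and> pawalk_verts s (map (\<lambda>k. ((f ^^ k) s, (f ^^ Suc k) s)) [0..<n])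
         = map (\<lambda>k. (f ^^ k) s) [0..<Suc n]"
  using assms(1)
proof (induction n arbitrary: s)
  case 0
  then show ?case by simp
next
  case (Suc n)
  have 1: "map (\<lambda>k. ((f ^^ k) s, (f ^^ Suc k) s)) [0..<Suc n]
      = (s, f s) # map (\<lambda>k. ((f ^^ k) (f s), (f ^^ Suc k) (f s))) [0..<n]"
    unfolding upt_conv_Cons[OF zero_less_Suc] map_Suc_upt[symmetric]
    by (simp add: funpow_swap1)
  have 2: "map (\<lambda>k. (f ^^ k) s) [0..<Suc (Suc n)] = s # map (\<lambda>k. (f ^^ k) (f s)) [0..<Suc n]"
    unfolding upt_conv_Cons[OF zero_less_Suc[of "Suc n"]] map_Suc_upt[symmetric]
    by (simp add: funpow_swap1 del: upt_Suc)
  have 3: "(f ^^ Suc n) s = (f ^^ n) (f s)"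
    by (simp add: funpow_swap1)
  have "f s \<in> S" using Suc.prems assms(2) by blast
  then show ?case
    unfolding 1 2 3 using Suc.IH[of "f s"] by (simp del: upt_Suc funpow.simps)
qed

lemma f_cycles_eq_orbits:
  assumes "finite S" "f permutes S"
  shows "f_cycles S f = (\<lambda>s. \<lparr> pverts = orbit f s, parcs = {(t, f t) |t. t \<in> orbit f s} \<rparr>) ` S"
    (is "?L = ?R")
proof (intro equalityI subsetI)
  note cyc = pre_digraph.cycle_def pre_digraph.awalk_def cas_with_proj_eq
    awalk_verts_with_proj_eq
  fix Z assume "Z \<in> ?L"
  then obtain p u where Z: "Z = \<lparr> pverts = fst ` set p, parcs = set p \<rparr>"
    and p: "u \<in> S" "set p \<subseteq> parcs (functional_graph S f)" "pcas u p u" "p \<noteq> []"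
    by (auto simp: f_cycles_def cyc functional_graph_def)
  let ?n = "length p"
  have pe: "p = map (\<lambda>k. ((f ^^ k) u, (f ^^ Suc k) u)) [0..<?n]" and u: "(f ^^ ?n) u = u"
    using functional_graph_walk[OF p(3,2)] by auto
  have orb: "orbit f u = {(f ^^ m) u |m. m < ?n}"
    using u p(4) by (intro orbit_altdef_bounded) auto
  have sp: "set p = (\<lambda>k. ((f ^^ k) u, (f ^^ Suc k) u)) ` {0..<?n}"
    by (subst pe) simp
  have "fst ` set p = orbit f u"
    unfolding sp orb image_image fst_conv by auto
  moreover have "set p = {(t, f t) |t. t \<in> orbit f u}"
    unfolding sp orb by auto
  ultimately have "Z = \<lparr> pverts = orbit f u, parcs = {(t, f t) |t. t \<in> orbit f u} \<rparr>"
    unfolding Z by (simp only:)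
  then show "Z \<in> ?R" using p(1) by (rule image_eqI)
next
  note cyc = pre_digraph.cycle_def pre_digraph.awalk_def cas_with_proj_eq
    awalk_verts_with_proj_eq
  fix Z assume "Z \<in> ?R"
  then obtain s where s: "s \<in> S"
    and Z: "Z = \<lparr> pverts = orbit f s, parcs = {(t, f t) |t. t \<in> orbit f s} \<rparr>"
    by (rule imageE)
  have so: "s \<in> orbit f s"
    by (rule permutation_self_in_orbit) (use assms permutation_permutes in blast)
  define n where "n = funpow_dist1 f s s"
  have n: "(f ^^ n) s = s" "0 < n"
    unfolding n_def using funpow_dist1_prop[OF so] by auto
  have orb: "orbit f s = {(f ^^ m) s |m. m < n}"
    by (rule orbit_altdef_bounded[OF n])
  have inS: "(f ^^ k) s \<in> S" for k
    using s assms(2) by (induction k) (auto simp: permutes_in_image)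
  let ?p = "map (\<lambda>k. ((f ^^ k) s, (f ^^ Suc k) s)) [0..<n]"
  have w: "pcas s ?p s" "pawalk_verts s ?p = map (\<lambda>k. (f ^^ k) s) [0..<Suc n]"
    using funpow_walk[of s S f n] s assms(2) n(1) by (auto simp: permutes_in_image)
  have inj: "inj_on (\<lambda>k. (f ^^ k) s) {0..<n}"
    unfolding n_def using inj_on_funpow_dist1[OF so] by simp
  have "tl (pawalk_verts s ?p) = map f (map (\<lambda>k. (f ^^ k) s) [0..<n])"
    unfolding w(2) upt_conv_Cons[OF zero_less_Suc] map_Suc_upt[symmetric] by simp
  moreover have "distinct (map f (map (\<lambda>k. (f ^^ k) s) [0..<n]))"
    using inj inj_on_subset[OF permutes_inj[OF assms(2)] subset_UNIV]
    by (subst distinct_map) (simp add: distinct_map)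
  moreover have "set ?p \<subseteq> parcs (functional_graph S f)"
    using inS by (auto simp: functional_graph_def)
  ultimately have "pre_digraph.cycle (with_proj (functional_graph S f)) ?p"
    using w(1) s n(2) unfolding cyc by (auto simp: functional_graph_def)
  moreover have "Z = \<lparr> pverts = fst ` set ?p, parcs = set ?p \<rparr>"
  proof -
    have "set ?p = {(t, f t) |t. t \<in> orbit f s}"
      unfolding orb by auto
    moreover have "fst ` {(t, f t) |t. t \<in> orbit f s} = orbit f s"
      unfolding setcompr_eq_image image_image fst_conv by simp
    ultimately show ?thesis
      unfolding Z by (simp only:)
  qed
  ultimately show "Z \<in> ?L" unfolding f_cycles_def by blast
qed

lemma induced_map_well_defined:
  assumes "finite S" "f permutes S" "g \<in> commuting_maps S f" "Z \<in> f_cycles S f"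
  shows "\<exists>!W. W \<in> f_cycles S f \<and> pverts W = g ` pverts Z"
proof -
  obtain s where s: "s \<in> S" and Z: "pverts Z = orbit f s"
    using assms(4) unfolding f_cycles_eq_orbits[OF assms(1,2)] by auto
  have inS: "(f ^^ k) s \<in> S" for k
    using s assms(2) by (induction k) (auto simp: permutes_in_image)
  have gs: "g s \<in> S" using s assms(3) by (auto simp: commuting_maps_def)
  have comm: "g (f t) = f (g t)" if "t \<in> S" for t
    using that assms(3) by (auto simp: commuting_maps_def)
  have "g ((f ^^ k) s) = (f ^^ k) (g s)" for k
    by (induction k) (simp_all add: comm inS)
  then have "g ` orbit f s = orbit f (g s)"
    unfolding orbit_altdef setcompr_eq_image image_image by simp
  then have eq: "g ` pverts Z = orbit f (g s)"
    by (simp only: Z)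
  let ?W = "\<lparr> pverts = orbit f (g s), parcs = {(t, f t) |t. t \<in> orbit f (g s)} \<rparr>"
  show ?thesis
  proof (rule ex1I[of _ ?W])
    show "?W \<in> f_cycles S f \<and> pverts ?W = g ` pverts Z"
      unfolding eq f_cycles_eq_orbits[OF assms(1,2)] using gs by simp
    show "W = ?W" if W: "W \<in> f_cycles S f \<and> pverts W = g ` pverts Z" for W
    proof -
      obtain t where "W = \<lparr> pverts = orbit f t, parcs = {(r, f r) |r. r \<in> orbit f t} \<rparr>"
        using W unfolding f_cycles_eq_orbits[OF assms(1,2)] by (elim conjE imageE)
      moreover from this have "orbit f t = orbit f (g s)"
        using W eq by simp
      ultimately show ?thesis by (simp only:)
    qed
  qed
qed

end

theory Submission
  imports Defs "HOL-Combinatorics.Cycles"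
begin

text \<open>
  Write a cycle as the orbit of any of its vertices. A map \<open>g\<close> that commutes with \<open>f\<close> satisfies
  \<open>g (f\<^sup>k s) = f\<^sup>k (g s)\<close>, so its value at one vertex of a cycle forces its values on the whole cycle;
  a set \<open>X\<close> with one vertex on each cycle therefore determines \<open>g\<close>. This is injectivity
  (\<open>commuting_maps_eqI\<close>).

  The only obstruction to prescribing the values of \<open>g\<close> on \<open>X\<close> is that \<open>f\<^sup>k s \<mapsto> f\<^sup>k y\<close> be well defined.
  As \<open>f\<^sup>k s = s\<close> holds exactly when the length of the cycle of \<open>s\<close> divides \<open>k\<close>
  (\<open>funpow_fixes_iff_card_orbit_dvd\<close>), it is well defined exactly when the length of the cycle of \<open>y\<close>
  divides the length of the cycle of \<open>s\<close>: necessity is \<open>card_orbit_dvd_of_commuting\<close>, sufficiency is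
  \<open>funpow_eq_transfer\<close>, which gives the extension \<open>commuting_extension_exists\<close>. The extension
  maps the cycle of \<open>s\<close> onto the cycle of \<open>y\<close>, and so it induces \<open>\<pi>\<close> as soon as \<open>y\<close> lies on the image
  cycle prescribed by \<open>\<pi>\<close>.

  The double indexing by length and position is a relabelling of the set of all cycles, and the chosen
  vertices amount to a choice function \<open>r\<close> from cycles to vertices, so it suffices to treat such an \<open>r\<close>
  (\<open>commuting_maps_bij_representatives\<close>).
\<close>

section \<open>Periods of powers of a permutation\<close>

lemma funpow_fixes_iff_card_orbit_dvd:
  assumes "permutation f"
  shows "(f ^^ k) s = s \<longleftrightarrow> card (orbit f s) dvd k"
proof -
  have "orbit f s = {(f ^^ m) s |m. m < least_power f s}"
    by (intro orbit_altdef_bounded least_power_of_permutation assms)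
  also have "\<dots> = set (support f s)"
    by auto
  finally have "card (orbit f s) = length (support f s)"
    using distinct_card[OF cycle_of_permutation[OF assms, of s]] by (simp only:)
  then show ?thesis
    using least_power_dvd[OF assms, of s k] by simp
qed

text \<open>
  A coincidence of two powers of \<open>f\<close> at \<open>s\<close> means that the exponents agree modulo the length of the
  cycle of \<open>s\<close>, hence also modulo any divisor of that length.
\<close>
lemma funpow_eq_transfer:
  assumes "permutation f" "card (orbit f y) dvd card (orbit f s)" "(f ^^ k) s = (f ^^ l) s"
  shows "(f ^^ k) y = (f ^^ l) y"
proof -
  have inj: "inj f"
    using assms(1) by (simp add: permutation bij_is_inj)
  have *: "(f ^^ a) y = (f ^^ b) y" if "a \<le> b" "(f ^^ a) s = (f ^^ b) s" for a b
  proof -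
    have "(f ^^ (b - a)) s = s"
      by (rule funpow_diff[OF inj that])
    then have "(f ^^ (b - a)) y = y"
      using assms(2) by (metis funpow_fixes_iff_card_orbit_dvd[OF assms(1)] dvd_trans)
    then show ?thesis
      using that(1) by (metis funpow_add le_add_diff_inverse comp_apply)
  qed
  show ?thesis
    using *[of k l] *[of l k] assms(3) by (metis nat_le_linear)
qed

lemma orbit_eq_range_funpow:
  assumes "permutation f"
  shows "orbit f s = range (\<lambda>k. (f ^^ k) s)"
  using orbit_altdef_permutation[OF assms, of s] by auto

lemma orbit_eq_of_mem:
  assumes "permutation f" "t \<in> orbit f s"
  shows "orbit f t = orbit f s"
  using assms by (meson equalityI orbit_swap orbit_trans permutation_self_in_orbit subsetI)

section \<open>Maps commuting with a permutation\<close>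

lemma commuting_maps_funpow:
  assumes "f permutes S" "g \<in> commuting_maps S f" "s \<in> S"
  shows "g ((f ^^ k) s) = (f ^^ k) (g s)"
proof (induction k)
  case (Suc k)
  have "(f ^^ k) s \<in> S"
    using assms(1,3) permutes_in_funpow_image by metis
  then have "f (g ((f ^^ k) s)) = g (f ((f ^^ k) s))"
    using assms(2) by (simp add: commuting_maps_def)
  then show ?case
    using Suc by simp
qed simp

lemma commuting_maps_image_orbit:
  assumes "finite S" "f permutes S" "g \<in> commuting_maps S f" "s \<in> S"
  shows "g ` orbit f s = orbit f (g s)"
proof -
  have "permutation f"
    using assms(1,2) permutation_permutes by blast
  then show ?thesis
    by (simp add: orbit_eq_range_funpow image_image commuting_maps_funpow[OF assms(2-4)])
qed

text \<open>
  If \<open>c\<close> is the length of the cycle of \<open>s\<close>, then \<open>f\<^sup>c\<close> fixes \<open>s\<close>, hence also \<open>g s\<close>.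
\<close>
lemma card_orbit_dvd_of_commuting:
  assumes "finite S" "f permutes S" "g \<in> commuting_maps S f" "s \<in> S"
  shows "card (orbit f (g s)) dvd card (orbit f s)"
proof -
  have perm: "permutation f"
    using assms(1,2) permutation_permutes by blast
  have "(f ^^ card (orbit f s)) (g s) = g ((f ^^ card (orbit f s)) s)"
    by (rule commuting_maps_funpow[OF assms(2-4), symmetric])
  also have "\<dots> = g s"
    using funpow_fixes_iff_card_orbit_dvd[OF perm] by (metis dvd_refl)
  finally show ?thesis
    by (simp add: funpow_fixes_iff_card_orbit_dvd[OF perm])
qed

lemma commuting_maps_eqI:
  assumes "finite S" "f permutes S" "g \<in> commuting_maps S f" "g' \<in> commuting_maps S f"
    and "Y \<subseteq> S" "S \<subseteq> (\<Union>y\<in>Y. orbit f y)" "\<And>y. y \<in> Y \<Longrightarrow> g y = g' y"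
  shows "g = g'"
proof (rule extensionalityI)
  show "g \<in> extensional S" "g' \<in> extensional S"
    using assms(3,4) by (auto simp: commuting_maps_def PiE_def)
  fix s assume "s \<in> S"
  then obtain y where y: "y \<in> Y" "s \<in> orbit f y"
    using assms(6) by blast
  then obtain k where "s = (f ^^ k) y"
    unfolding orbit_altdef by blast
  then show "g s = g' s"
    using y assms by (metis commuting_maps_funpow subsetD)
qed

text \<open>
  The function \<open>rep\<close> picks one point on each orbit and \<open>h\<close> prescribes the values at these points.
  Any exponent that leads from \<open>rep s\<close> to \<open>s\<close> may be used to define the value at \<open>s\<close>.
\<close>
lemma commuting_extension_exists:
  assumes "finite S" "f permutes S"
    and rep: "\<And>s. s \<in> S \<Longrightarrow> rep s \<in> S \<and> s \<in> orbit f (rep s)"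
    and rep_step: "\<And>s. s \<in> S \<Longrightarrow> rep (f s) = rep s"
    and h: "\<And>s. s \<in> S \<Longrightarrow> h (rep s) \<in> S"
    and dvd: "\<And>s. s \<in> S \<Longrightarrow> card (orbit f (h (rep s))) dvd card (orbit f (rep s))"
  shows "\<exists>g \<in> commuting_maps S f. \<forall>s\<in>S. g (rep s) = h (rep s)"
proof -
  have perm: "permutation f"
    using assms(1,2) permutation_permutes by blast
  have inS: "f t \<in> S \<longleftrightarrow> t \<in> S" "(f ^^ k) t \<in> S \<longleftrightarrow> t \<in> S" for t k
    using permutes_in_image[OF assms(2)] permutes_in_image[OF permutes_funpow[OF assms(2)]]
    by blast+
  define e where "e s = (SOME k. (f ^^ k) (rep s) = s)" for s
  define g where "g = (\<lambda>s\<in>S. (f ^^ e s) (h (rep s)))"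
  have e: "(f ^^ e s) (rep s) = s" if "s \<in> S" for s
  proof -
    have "\<exists>k. (f ^^ k) (rep s) = s"
      using rep[OF that] by (auto simp: orbit_altdef intro: sym)
    then show ?thesis
      unfolding e_def by (rule someI_ex)
  qed
  have g_eq: "g s = (f ^^ k) (h (rep s))" if "s \<in> S" "(f ^^ k) (rep s) = s" for s k
    unfolding g_def using that e funpow_eq_transfer[OF perm dvd] by simp
  \<comment> \<open>One further step of \<open>f\<close> leads from \<open>rep s = rep (f s)\<close> to \<open>f s\<close>.\<close>
  have "f (g s) = g (f s)" if "s \<in> S" for s
    using that e[OF that] g_eq[of "f s" "Suc (e s)"] g_eq[of s "e s"]
    by (simp add: inS rep_step)
  moreover have "g s \<in> S" if "s \<in> S" for s
    using that h[OF that] by (simp add: g_def inS)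
  ultimately have "g \<in> commuting_maps S f"
    by (auto simp: commuting_maps_def g_def)
  moreover have "g (rep s) = h (rep s)" if s: "s \<in> S" for s
  proof -
    \<comment> \<open>As \<open>rep\<close> is constant along the orbit from \<open>rep s\<close> to \<open>s\<close>, the point \<open>rep s\<close> represents
      itself, so the exponent 0 is admissible there.\<close>
    have "rep ((f ^^ k) (rep s)) = rep (rep s)" for k
      by (induction k) (use rep[OF s] in \<open>simp_all add: inS rep_step\<close>)
    from this[of "e s"] have "rep (rep s) = rep s"
      by (simp add: e[OF s])
    then show ?thesis
      using g_eq[of "rep s" 0] rep[OF s] by simp
  qed
  ultimately show ?thesis
    by blast
qed

section \<open>Cycles as orbits\<close>

definition cycle_at :: "('a \<Rightarrow> 'a) \<Rightarrow> 'a \<Rightarrow> 'a pair_pre_digraph" where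
  "cycle_at f s = \<lparr> pverts = orbit f s, parcs = {(t, f t) |t. t \<in> orbit f s} \<rparr>"

lemma cycle_at_simps:
  "pverts (cycle_at f s) = orbit f s"
  "cycle_length (cycle_at f s) = card (orbit f s)"
proof -
  have "{(t, f t) |t. t \<in> orbit f s} = (\<lambda>t. (t, f t)) ` orbit f s"
    by blast
  then show "cycle_length (cycle_at f s) = card (orbit f s)"
    by (simp add: cycle_at_def cycle_length_def card_image inj_on_def)
qed (simp add: cycle_at_def)

lemma f_cycles_eq_image_cycle_at:
  assumes "finite S" "f permutes S"
  shows "f_cycles S f = cycle_at f ` S"
  unfolding f_cycles_eq_orbits[OF assms] cycle_at_def ..

lemma f_cycle_eq_cycle_at:
  assumes "finite S" "f permutes S" "C \<in> f_cycles S f" "t \<in> pverts C"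
  shows "t \<in> S" "C = cycle_at f t"
proof -
  have perm: "permutation f"
    using assms(1,2) permutation_permutes by blast
  obtain s where s: "s \<in> S" "C = cycle_at f s"
    using assms(3) unfolding f_cycles_eq_image_cycle_at[OF assms(1,2)] by blast
  then have t: "t \<in> orbit f s"
    using assms(4) by (simp add: cycle_at_simps)
  show "t \<in> S"
    using permutes_orbit_subset[OF assms(2) s(1)] t by blast
  show "C = cycle_at f t"
    unfolding s(2) cycle_at_def orbit_eq_of_mem[OF perm t] ..
qed

lemma induced_map_cycle_at:
  assumes "finite S" "f permutes S" "g \<in> commuting_maps S f" "s \<in> S"
  shows "induced_map S f g (cycle_at f s) = cycle_at f (g s)"
proof -
  have C: "cycle_at f s \<in> f_cycles S f" "cycle_at f (g s) \<in> f_cycles S f"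
    using assms by (auto simp: f_cycles_eq_image_cycle_at commuting_maps_def)
  have "pverts (cycle_at f (g s)) = g ` pverts (cycle_at f s)"
    by (simp add: cycle_at_simps commuting_maps_image_orbit[OF assms])
  then show ?thesis
    using C the1_equality[OF induced_map_well_defined[OF assms(1-3) C(1)]]
    by (simp add: induced_map_def)
qed

section \<open>The bijection\<close>

text \<open>
  The representatives are given by a choice function on the set of cycles. In the proof, every condition
  on a cycle \<open>C\<close> becomes a condition on the orbit of its representative \<open>r C\<close>.
\<close>
theorem commuting_maps_bij_representatives:
  assumes "finite S" "f permutes S"
    and r: "\<And>C. C \<in> f_cycles S f \<Longrightarrow> r C \<in> pverts C"
  shows "bij_betw (\<lambda>g. (induced_map S f g, restrict g (r ` f_cycles S f)))
    (commuting_maps S f)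
    {(\<pi>, h).
       \<pi> \<in> f_cycles S f \<rightarrow>\<^sub>E f_cycles S f \<and>
       (\<forall>C \<in> f_cycles S f. card (pverts (\<pi> C)) dvd card (pverts C)) \<and>
       h \<in> r ` f_cycles S f \<rightarrow>\<^sub>E S \<and>
       (\<forall>C \<in> f_cycles S f. h (r C) \<in> pverts (\<pi> C))}"
    (is "bij_betw ?F ?G ?P")
proof -
  let ?Cs = "f_cycles S f"
  let ?X = "r ` ?Cs"
  have perm: "permutation f"
    using assms(1,2) permutation_permutes by blast
  have self: "s \<in> orbit f s" for s
    by (rule permutation_self_in_orbit[OF perm])
  have rS: "r C \<in> S" and C_eq: "cycle_at f (r C) = C" if "C \<in> ?Cs" for C
    using f_cycle_eq_cycle_at[OF assms(1,2) that r[OF that]] by simp_all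
  have verts: "pverts C = orbit f (r C)" if "C \<in> ?Cs" for C
    using C_eq[OF that] cycle_at_simps(1) by metis
  have at: "cycle_at f s \<in> ?Cs" if "s \<in> S" for s
    using that by (simp add: f_cycles_eq_image_cycle_at[OF assms(1,2)])
  have ind: "induced_map S f g C = cycle_at f (g (r C))" if "g \<in> ?G" "C \<in> ?Cs" for g C
    using induced_map_cycle_at[OF assms(1,2) that(1) rS[OF that(2)]] C_eq[OF that(2)] by simp
  have GS: "g s \<in> S" if "g \<in> ?G" "s \<in> S" for g s
    using that by (auto simp: commuting_maps_def)
  have s_rep: "s \<in> orbit f (r (cycle_at f s))" if "s \<in> S" for s
    using verts[OF at[OF that]] self[of s] by (simp add: cycle_at_simps)
  show ?thesis
  proof (rule bij_betwI')
    fix g g' assume g: "g \<in> ?G" "g' \<in> ?G"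
    show "?F g = ?F g' \<longleftrightarrow> g = g'"
    proof
      assume "?F g = ?F g'"
      then have eq: "restrict g ?X = restrict g' ?X"
        by simp
      have "g y = g' y" if "y \<in> ?X" for y
        using fun_cong[OF eq, of y] that by (simp only: restrict_apply')
      moreover have "S \<subseteq> (\<Union>y\<in>?X. orbit f y)"
        using s_rep at by blast
      ultimately show "g = g'"
        using rS by (intro commuting_maps_eqI[OF assms(1,2) g, of ?X]) auto
    qed simp
  next
    fix g assume g: "g \<in> ?G"
    have "induced_map S f g \<in> ?Cs \<rightarrow>\<^sub>E ?Cs"
      using ind[OF g] at GS[OF g] rS by (auto simp: induced_map_def PiE_def extensional_def)
    moreover have "restrict g ?X \<in> ?X \<rightarrow>\<^sub>E S"
      using GS[OF g] rS by auto
    moreover have "\<forall>C \<in> ?Cs. card (pverts (induced_map S f g C)) dvd card (pverts C)"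
      using card_orbit_dvd_of_commuting[OF assms(1,2) g] rS
      by (simp add: ind[OF g] verts cycle_at_simps)
    moreover have "\<forall>C \<in> ?Cs. restrict g ?X (r C) \<in> pverts (induced_map S f g C)"
      using self by (simp add: ind[OF g] cycle_at_simps)
    ultimately show "?F g \<in> ?P"
      unfolding mem_Collect_eq case_prod_conv by (intro conjI)
  next
    fix p assume "p \<in> ?P"
    moreover obtain \<pi> h where p: "p = (\<pi>, h)"
      by (rule prod.exhaust)
    ultimately have \<pi>: "\<pi> \<in> ?Cs \<rightarrow>\<^sub>E ?Cs"
      and dvd: "\<And>C. C \<in> ?Cs \<Longrightarrow> card (pverts (\<pi> C)) dvd card (pverts C)"
      and h: "h \<in> ?X \<rightarrow>\<^sub>E S" and h\<pi>: "\<And>C. C \<in> ?Cs \<Longrightarrow> h (r C) \<in> pverts (\<pi> C)"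
      unfolding mem_Collect_eq case_prod_conv by blast+
    have \<pi>_eq: "\<pi> C = cycle_at f (h (r C))" if "C \<in> ?Cs" for C
      using f_cycle_eq_cycle_at(2)[OF assms(1,2) PiE_mem[OF \<pi> that] h\<pi>[OF that]] .
    let ?rep = "\<lambda>s. r (cycle_at f s)"
    have "\<exists>g \<in> ?G. \<forall>s\<in>S. g (?rep s) = h (?rep s)"
    proof (rule commuting_extension_exists[OF assms(1,2), of ?rep h])
      fix s assume s: "s \<in> S"
      show "?rep s \<in> S \<and> s \<in> orbit f (?rep s)"
        using rS[OF at[OF s]] s_rep[OF s] by blast
      show "?rep (f s) = ?rep s"
        by (simp add: cycle_at_def permutation_orbit_step[OF perm])
      show "h (?rep s) \<in> S"
        using PiE_mem[OF h] at[OF s] by blast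
      show "card (orbit f (h (?rep s))) dvd card (orbit f (?rep s))"
        using dvd[OF at[OF s]] verts[OF at[OF s]] \<pi>_eq[OF at[OF s]]
        by (simp add: cycle_at_simps)
    qed
    then obtain g where g: "g \<in> ?G" and gh: "\<And>s. s \<in> S \<Longrightarrow> g (?rep s) = h (?rep s)"
      by blast
    have g_r: "g (r C) = h (r C)" if "C \<in> ?Cs" for C
      using gh[OF rS[OF that]] C_eq[OF that] by simp
    have "induced_map S f g = \<pi>"
    proof (rule extensionalityI)
      show "induced_map S f g \<in> extensional ?Cs" "\<pi> \<in> extensional ?Cs"
        using \<pi> by (auto simp: induced_map_def PiE_def)
      show "induced_map S f g C = \<pi> C" if "C \<in> ?Cs" for C
        by (simp add: ind[OF g that] \<pi>_eq[OF that] g_r[OF that])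
    qed
    moreover have "restrict g ?X = h"
    proof (rule extensionalityI)
      show "restrict g ?X \<in> extensional ?X" "h \<in> extensional ?X"
        using h by (auto simp: PiE_def)
      show "restrict g ?X y = h y" if "y \<in> ?X" for y
        using that g_r by auto
    qed
    ultimately show "\<exists>g \<in> ?G. p = ?F g"
      using g p by blast
  qed
qed

theorem theorem2p17:
  fixes S :: "'a set" and f :: "'a \<Rightarrow> 'a"
    and n :: "nat \<Rightarrow> nat"
    and Z :: "nat \<Rightarrow> nat \<Rightarrow> 'a pair_pre_digraph"
    and x :: "nat \<Rightarrow> nat \<Rightarrow> 'a"
    and X :: "'a set"
  assumes "finite S" and "f permutes S"
    and "\<And>i. bij_betw (Z i) {1..n i} {C \<in> f_cycles S f. cycle_length C = i}"
    and "\<And>i j. j \<in> {1..n i} \<Longrightarrow> x i j \<in> pverts (Z i j)"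
    and "X = {x i j |i j. j \<in> {1..n i}}"
  shows "bij_betw (\<lambda>g. (induced_map S f g, restrict g X))
    (commuting_maps S f)
    {(\<pi>, h).
       \<pi> \<in> f_cycles S f \<rightarrow>\<^sub>E f_cycles S f \<and>
       (\<forall>i. \<forall>j\<in>{1..n i}. card (pverts (\<pi> (Z i j))) dvd i) \<and>
       h \<in> X \<rightarrow>\<^sub>E S \<and>
       (\<forall>i. \<forall>j\<in>{1..n i}. h (x i j) \<in> pverts (\<pi> (Z i j)))}"
proof -
  let ?Cs = "f_cycles S f"
  have ZC: "Z i j \<in> ?Cs" "cycle_length (Z i j) = i" if "j \<in> {1..n i}" for i j
    using bij_betwE[OF assms(3)[of i]] that by blast+
  have card_verts: "card (pverts C) = cycle_length C" if "C \<in> ?Cs" for C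
    using that by (auto simp: f_cycles_eq_image_cycle_at[OF assms(1,2)] cycle_at_simps)
  define pos where "pos C = inv_into {1..n (cycle_length C)} (Z (cycle_length C)) C" for C
  define r where "r C = x (cycle_length C) (pos C)" for C
  have pos: "pos C \<in> {1..n (cycle_length C)}" "Z (cycle_length C) (pos C) = C"
    if "C \<in> ?Cs" for C
  proof -
    have C: "C \<in> Z (cycle_length C) ` {1..n (cycle_length C)}"
      using assms(3)[of "cycle_length C"] that unfolding bij_betw_def by blast
    show "pos C \<in> {1..n (cycle_length C)}"
      unfolding pos_def by (rule inv_into_into[OF C])
    show "Z (cycle_length C) (pos C) = C"
      unfolding pos_def by (rule f_inv_into_f[OF C])
  qed
  have r_Z: "r (Z i j) = x i j" if "j \<in> {1..n i}" for i j
    using bij_betw_imp_inj_on[OF assms(3)[of i]] that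
    by (simp add: r_def pos_def ZC(2)[OF that] inv_into_f_f)
  have r: "r C \<in> pverts C" if "C \<in> ?Cs" for C
    using assms(4)[OF pos(1)[OF that]] pos(2)[OF that] by (simp add: r_def)
  \<comment> \<open>A condition on all pairs of indices is a condition on all cycles.\<close>
  have all: "(\<forall>i. \<forall>j\<in>{1..n i}. Q i (x i j) (Z i j)) \<longleftrightarrow> (\<forall>C\<in>?Cs. Q (card (pverts C)) (r C) C)"
    for Q :: "nat \<Rightarrow> 'a \<Rightarrow> 'a pair_pre_digraph \<Rightarrow> bool"
  proof (intro iffI ballI allI)
    fix C assume "\<forall>i. \<forall>j\<in>{1..n i}. Q i (x i j) (Z i j)" and C: "C \<in> ?Cs"
    then have "Q (cycle_length C) (r C) (Z (cycle_length C) (pos C))"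
      using pos(1)[OF C] unfolding r_def by blast
    then show "Q (card (pverts C)) (r C) C"
      by (simp add: pos(2)[OF C] card_verts[OF C])
  next
    fix i j assume Q: "\<forall>C\<in>?Cs. Q (card (pverts C)) (r C) C" and j: "j \<in> {1..n i}"
    show "Q i (x i j) (Z i j)"
      using bspec[OF Q ZC(1)[OF j]] by (simp add: card_verts[OF ZC(1)[OF j]] ZC(2)[OF j] r_Z[OF j])
  qed
  have X: "X = r ` ?Cs"
  proof (intro equalityI subsetI)
    fix y assume "y \<in> X"
    then obtain i j where "j \<in> {1..n i}" "y = x i j"
      using assms(5) by blast
    then show "y \<in> r ` ?Cs"
      using r_Z ZC(1) by (metis imageI)
  next
    fix y assume "y \<in> r ` ?Cs"
    then show "y \<in> X"
      unfolding assms(5) r_def using pos(1) by blast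
  qed
  show ?thesis
    unfolding X
      all[of "\<lambda>i y C. card (pverts (\<pi> C)) dvd i" for \<pi>]
      all[of "\<lambda>i y C. h y \<in> pverts (\<pi> C)" for h \<pi>]
    by (rule commuting_maps_bij_representatives[OF assms(1,2) r])
qed

end
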